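(* Let $P\subseteq\mathbb{R}^n$ be a polytope, $\|\cdot\|$ an arbitrary norm on $\mathbb{R}^n$ with dual norm $\|\cdot\|_*$, and $D=\max_{y_1,y_2\in P}\|y_1-y_2\|$. Let $0\le b,s<1$ and $K\ge1$. Let $f_1,f_2,\dots$ be convex differentiable functions that are $L$-Lipschitz and such that $f_t$ is smooth with curvature at most $Ct^{-b}$. For $T\ge1$ let $x_T^*$ be a minimizer of $\sum_{t=1}^Tf_t$ over $P$, and let $x_t$ be the points computed by the Lazy Online Conditional Gradient algorithm (described in the context). (1) If the algorithm is run with $\gamma_t=t^{-(1-b)/2}$ and with the strong-convexity terms omitted (i.e. $h_1=\|\nabla_1\|_*D$ and $h_t=\Phi_{t-1}+\|\nabla_t\|_*D$), then $$\frac1T\sum_{t=1}^T\big(f_t(x_T)-f_t(x_T^* )\big)\le A\,T^{-(1-b)/2},\qquad A=\frac{CK}{2(1-b)}+L(K+1)D.$$ (2) If moreover every $f_t$ is $St^{-s}$-strongly convex with respect to $\|\cdot\|$ (with $S>0$ the parameter given to the algorithm), then with $\gamma_t=t^{(b+s-2)/3}$, $$\frac1T\sum_{t=1}^T\big(f_t(x_T)-f_t(x_T^* )\big)\le A\,T^{-(2(1+b)-s)/3},\qquad A=2\Big((K+1)(K+2)\frac{L^2}{S}+\frac{CK}{2(1-b)}\Big).$$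
   Context: $f$ is $L$-Lipschitz if $|f(y)-f(x)|\le L\|y-x\|$; smooth with curvature at most $C'$ if $f(\gamma y+(1-\gamma)x)\le f(x)+\gamma\nabla f(x)(y-x)+C'\gamma^2/2$ for $x,y$ in the domain and $0\le\gamma\le1$; $S'$-strongly convex if $f(y)-f(x)\ge\nabla f(x)(y-x)+\frac{S'}2\|y-x\|^2$. Weak separation oracle $\mathrm{LPsep}_P(c,x,\Phi,K)$: given $c$, $x\in P$, $\Phi>0$, $K\ge1$, returns either a vertex $y$ of $P$ with $c(x-y)>\Phi/K$, or false, which it may return only if $c(x-z)\le\Phi$ for all $z\in P$. Lazy Online Conditional Gradient algorithm (inputs: $f_t$, start vertex $x_1$ of $P$, the oracle, parameters $K,C,b,S,s$, diameter $D$, step sizes $\gamma_t$): for $t=1,\dots,T-1$: let $\nabla_t=\nabla f_t(x_t)$. If $t=1$, $h_1=\min\{\|\nabla_1\|_*D,\,2\|\nabla_1\|_*^2/S\}$; otherwise $$h_t=\Phi_{t-1}+\min\Big\{\|\nabla_t\|_*D,\ \frac{\|\nabla_t\|_*^2}{St^{1-s}}+2\sqrt{\frac{\|\nabla_t\|_*^2}{2St^{1-s}}\Big(\frac{\|\nabla_t\|_*^2}{2St^{1-s}}+\Phi_{t-1}\Big)}\Big\}.$$ Set $\Phi_t=\dfrac{h_t+\frac{Ct^{1-b}\gamma_t^2}{2(1-b)}}{1+\gamma_t/K}$ and $v_t=\mathrm{LPsep}_P\big(\sum_{i=1}^t\nabla f_i(x_t),x_t,\Phi_t,K\big)$. If $v_t$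 is false put $x_{t+1}=x_t$; otherwise put $x_{t+1}=(1-\gamma_t)x_t+\gamma_tv_t$ and redefine $\Phi_t=h_t-\sum_{i=1}^tf_i(x_t)+\sum_{i=1}^tf_i(x_{t+1})$. *)

theory Defs
  imports "HOL-Analysis.Analysis"
begin

definition is_norm :: "('a::euclidean_space \<Rightarrow> real) \<Rightarrow> bool" where
  "is_norm N \<longleftrightarrow>
     (\<forall>x. 0 \<le> N x) \<and> (\<forall>x. N x = 0 \<longleftrightarrow> x = 0) \<and>
     (\<forall>a x. N (a *\<^sub>R x) = \<bar>a\<bar> * N x) \<and>
     (\<forall>x y. N (x + y) \<le> N x + N y)"

text \<open>Covectors are identified with vectors through the standard inner product.\<close>

definition dual_norm :: "('a::euclidean_space \<Rightarrow> real) \<Rightarrow> 'a \<Rightarrow> real" where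
  "dual_norm N c = (SUP x\<in>{x. N x \<le> 1}. c \<bullet> x)"

text \<open>On a nonempty polytope the supremum is attained, hence is the maximum.\<close>

definition norm_diameter :: "('a::euclidean_space \<Rightarrow> real) \<Rightarrow> 'a set \<Rightarrow> real" where
  "norm_diameter N P = Sup {N (y1 - y2) | y1 y2. y1 \<in> P \<and> y2 \<in> P}"

text \<open>The gradient of a function with domain \<open>X\<close>. If \<open>X\<close> is convex with nonempty interior,
  the derivative within \<open>X\<close> is unique at every point of \<open>X\<close>, boundary points included.\<close>

definition gradient :: "'a::euclidean_space set \<Rightarrow> ('a \<Rightarrow> real) \<Rightarrow> 'a \<Rightarrow> 'a" where
  "gradient X f x = (THE g. (f has_derivative (\<lambda>h. g \<bullet> h)) (at x within X))"

definition lipschitz_wrt ::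
  "('a::euclidean_space \<Rightarrow> real) \<Rightarrow> 'a set \<Rightarrow> real \<Rightarrow> ('a \<Rightarrow> real) \<Rightarrow> bool" where
  "lipschitz_wrt N X L f \<longleftrightarrow> (\<forall>x\<in>X. \<forall>y\<in>X. \<bar>f y - f x\<bar> \<le> L * N (y - x))"

text \<open>In the next two definitions \<open>X\<close> is the domain of \<open>f\<close>, which only determines the gradient;
  the inequality is required for points of \<open>P \<subseteq> X\<close>.\<close>

definition smooth_with_curvature ::
  "'a::euclidean_space set \<Rightarrow> 'a set \<Rightarrow> real \<Rightarrow> ('a \<Rightarrow> real) \<Rightarrow> bool" where
  "smooth_with_curvature X P C' f \<longleftrightarrow>
     (\<forall>x\<in>P. \<forall>y\<in>P. \<forall>\<gamma>. 0 \<le> \<gamma> \<and> \<gamma> \<le> 1 \<longrightarrow>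
        f (\<gamma> *\<^sub>R y + (1 - \<gamma>) *\<^sub>R x)
          \<le> f x + \<gamma> * (gradient X f x \<bullet> (y - x)) + C' * \<gamma>\<^sup>2 / 2)"

definition strongly_convex_wrt ::
  "('a::euclidean_space \<Rightarrow> real) \<Rightarrow> 'a set \<Rightarrow> 'a set \<Rightarrow> real \<Rightarrow> ('a \<Rightarrow> real) \<Rightarrow> bool" where
  "strongly_convex_wrt N X P S' f \<longleftrightarrow>
     (\<forall>x\<in>P. \<forall>y\<in>P. f y - f x \<ge> gradient X f x \<bullet> (y - x) + S' / 2 * (N (y - x))\<^sup>2)"

text \<open>\<open>LPsep_answer P c x \<Phi> K v\<close>: the weak separation oracle may answer \<open>v\<close>, where \<open>None\<close> is the
  answer ``false''. A relation rather than a function, since the oracle need not answer equal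
  queries equally. Oracle inputs have \<open>\<Phi> > 0\<close>; in the algorithm \<open>\<Phi> = 0\<close> can also arise, but only
  in the degenerate case that \<open>C = 0\<close> and the current point is already optimal, and there the
  specification is read with \<open>\<Phi> = 0\<close>.\<close>

definition LPsep_answer ::
  "'a::euclidean_space set \<Rightarrow> 'a \<Rightarrow> 'a \<Rightarrow> real \<Rightarrow> real \<Rightarrow> 'a option \<Rightarrow> bool" where
  "LPsep_answer P c x \<Phi> K v \<longleftrightarrow>
     (case v of
        Some y \<Rightarrow> y extreme_point_of P \<and> c \<bullet> (x - y) > \<Phi> / K
      | None \<Rightarrow> (\<forall>z\<in>P. c \<bullet> (x - z) \<le> \<Phi>))"

text \<open>The two rules for \<open>h\<^sub>t\<close>, as functions of \<open>t\<close>, of \<open>g\<close>, the dual norm of the gradient of \<open>f\<^sub>t\<close>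
  at \<open>x\<^sub>t\<close>, and of \<open>\<phi> = \<Phi>\<^bsub>t-1\<^esub>\<close> (ignored for \<open>t = 1\<close>): without and with the strong-convexity terms.\<close>

definition h_plain :: "real \<Rightarrow> nat \<Rightarrow> real \<Rightarrow> real \<Rightarrow> real" where
  "h_plain D t g \<phi> = (if t = 1 then g * D else \<phi> + g * D)"

definition h_strong :: "real \<Rightarrow> real \<Rightarrow> real \<Rightarrow> nat \<Rightarrow> real \<Rightarrow> real \<Rightarrow> real" where
  "h_strong D S s t g \<phi> =
     (if t = 1 then min (g * D) (2 * g\<^sup>2 / S)
      else \<phi> + min (g * D)
        (g\<^sup>2 / (S * real t powr (1 - s))
         + 2 * sqrt (g\<^sup>2 / (2 * S * real t powr (1 - s))
                     * (g\<^sup>2 / (2 * S * real t powr (1 - s)) + \<phi>))))"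

text \<open>\<open>x\<close> and \<open>\<Phi>\<close> are the values computed in the iterations \<open>1, \<dots>, T - 1\<close> of the Lazy Online
  Conditional Gradient algorithm; \<open>\<Phi> t\<close> is the final value of iteration \<open>t\<close>, whereas \<open>\<Phi>'\<close> is the
  value passed to the oracle.\<close>

definition lazy_ocg_run ::
  "('a::euclidean_space \<Rightarrow> real) \<Rightarrow> 'a set \<Rightarrow> 'a set \<Rightarrow> (nat \<Rightarrow> 'a \<Rightarrow> real) \<Rightarrow>
   real \<Rightarrow> real \<Rightarrow> real \<Rightarrow> (nat \<Rightarrow> real) \<Rightarrow> (nat \<Rightarrow> real \<Rightarrow> real \<Rightarrow> real) \<Rightarrow>
   nat \<Rightarrow> (nat \<Rightarrow> 'a) \<Rightarrow> (nat \<Rightarrow> real) \<Rightarrow> bool" where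
  "lazy_ocg_run N X P f K C b \<gamma> H T x \<Phi> \<longleftrightarrow>
     x 1 extreme_point_of P \<and>
     (\<forall>t\<in>{1..<T}. \<exists>v.
        let h = H t (dual_norm N (gradient X (f t) (x t))) (\<Phi> (t - 1));
            \<Phi>' = (h + C * real t powr (1 - b) * (\<gamma> t)\<^sup>2 / (2 * (1 - b))) / (1 + \<gamma> t / K)
        in LPsep_answer P (\<Sum>i=1..t. gradient X (f i) (x t)) (x t) \<Phi>' K v \<and>
           (case v of
              None \<Rightarrow> x (t + 1) = x t \<and> \<Phi> t = \<Phi>'
            | Some y \<Rightarrow> x (t + 1) = (1 - \<gamma> t) *\<^sub>R x t + \<gamma> t *\<^sub>R y \<and>
                \<Phi> t = h - (\<Sum>i=1..t. f i (x t)) + (\<Sum>i=1..t. f i (x (t + 1)))))"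

end

theory Submission
  imports Defs
begin

text \<open>
  Let \<open>F\<^sub>t = f\<^sub>1 + \<dots> + f\<^sub>t\<close>. Two invariants are carried along the run. First, \<open>h\<^sub>t\<close> bounds the primal
  gap of \<open>F\<^sub>t\<close> at \<open>x\<^sub>t\<close> and \<open>\<Phi>\<^sub>t\<close> bounds the gap of \<open>F\<^sub>t\<close> at \<open>x\<^bsub>t+1\<^esub>\<close>: a negative oracle answer
  certifies it by convexity, a positive one changes gap and bound by the same amount. Passing
  from \<open>F\<^sub>t\<close> to \<open>F\<^bsub>t+1\<^esub>\<close> costs at most the dual norm of the new gradient times the distance to the
  minimizer of \<open>F\<^bsub>t+1\<^esub>\<close>, which is at most \<open>D\<close>, or, under strong convexity, controlled by the
  square root of the gap itself. Second, in both cases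
  \<open>\<Phi>\<^sub>t \<le> (h\<^sub>t + C t\<^bsup>1-b\<^esup> \<gamma>\<^sub>t\<^sup>2 / (2 (1 - b))) / (1 + \<gamma>\<^sub>t / K)\<close>, and the resulting recursion
  for \<open>h\<^sub>t\<close> is solved by \<open>h\<^sub>t \<le> A t\<^sup>e\<close> with \<open>e = (1 - b) / 2\<close>, respectively
  \<open>e = (1 + s - 2 b) / 3\<close>. The latter needs \<open>e \<ge> 0\<close>, which holds because strong convexity and bounded
  curvature together force \<open>b \<le> s\<close> unless \<open>P\<close> is a point.
\<close>

section \<open>Arbitrary norms, the diameter and the dual norm\<close>

lemma is_norm_zero [simp]: "is_norm N \<Longrightarrow> N 0 = 0"
  by (simp add: is_norm_def)

lemma is_norm_nonneg: "is_norm N \<Longrightarrow> 0 \<le> N x"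
  by (simp add: is_norm_def)

lemma is_norm_scaleR: "is_norm N \<Longrightarrow> N (a *\<^sub>R x) = \<bar>a\<bar> * N x"
  by (simp add: is_norm_def)

lemma is_norm_pos: "is_norm N \<Longrightarrow> x \<noteq> 0 \<Longrightarrow> 0 < N x"
  unfolding is_norm_def by (metis less_eq_real_def)

lemma is_norm_minus: "is_norm N \<Longrightarrow> N (- x) = N x"
  using is_norm_scaleR[of N "-1" x] by simp

lemma is_norm_minus_commute: "is_norm N \<Longrightarrow> N (x - y) = N (y - x)"
  using is_norm_minus[of N "x - y"] by simp

lemma is_norm_norm: "is_norm (norm :: 'a::euclidean_space \<Rightarrow> real)"
  by (simp add: is_norm_def norm_triangle_ineq)

text \<open>Basis expansion and the triangle inequality. Distances in \<open>N\<close> are thus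
  bounded on a bounded set, which makes the \<open>Sup\<close> in \<open>norm_diameter\<close> a
  genuine upper bound.\<close>

lemma is_norm_bounded_by_norm:
  fixes N :: "'a::euclidean_space \<Rightarrow> real"
  assumes "is_norm N"
  shows "N x \<le> (\<Sum>i\<in>Basis. N i) * norm x"
proof -
  have sum: "N (\<Sum>i\<in>A. g i) \<le> (\<Sum>i\<in>A. N (g i))" if "finite A" for A and g :: "'a \<Rightarrow> 'a"
    using that
  proof (induction A)
    case (insert a A)
    have "N (g a + (\<Sum>i\<in>A. g i)) \<le> N (g a) + N (\<Sum>i\<in>A. g i)"
      using assms by (simp add: is_norm_def)
    then show ?case using insert by simp
  qed (simp add: assms)
  have "N x = N (\<Sum>i\<in>Basis. (x \<bullet> i) *\<^sub>R i)" by (simp add: euclidean_representation)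
  also have "\<dots> \<le> (\<Sum>i\<in>Basis. N ((x \<bullet> i) *\<^sub>R i))" by (rule sum) simp
  also have "\<dots> \<le> (\<Sum>i\<in>Basis. norm x * N i)"
    by (rule sum_mono)
      (simp add: is_norm_scaleR[OF assms] mult_right_mono Basis_le_norm is_norm_nonneg[OF assms])
  also have "\<dots> = (\<Sum>i\<in>Basis. N i) * norm x"
    by (simp add: sum_distrib_left mult.commute)
  finally show ?thesis .
qed

lemma norm_diameter_upper:
  assumes "is_norm N" "bounded P" "x \<in> P" "y \<in> P"
  shows "N (x - y) \<le> norm_diameter N P"
  unfolding norm_diameter_def
proof (rule cSup_upper)
  obtain B where B: "\<And>x. x \<in> P \<Longrightarrow> norm x \<le> B" using assms(2) by (auto simp: bounded_iff)
  show "bdd_above {N (y1 - y2) |y1 y2. y1 \<in> P \<and> y2 \<in> P}"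
  proof (rule bdd_aboveI)
    fix r assume "r \<in> {N (y1 - y2) |y1 y2. y1 \<in> P \<and> y2 \<in> P}"
    then obtain y1 y2 where r: "r = N (y1 - y2)" "y1 \<in> P" "y2 \<in> P" by auto
    have "norm (y1 - y2) \<le> B + B"
      using norm_triangle_ineq4[of y1 y2] B[OF r(2)] B[OF r(3)] by linarith
    then have "(\<Sum>i\<in>Basis. N i) * norm (y1 - y2) \<le> (\<Sum>i\<in>Basis. N i) * (B + B)"
      by (intro mult_left_mono sum_nonneg is_norm_nonneg assms)
    then show "r \<le> (\<Sum>i\<in>Basis. N i) * (B + B)"
      using is_norm_bounded_by_norm[OF assms(1), of "y1 - y2"] r by linarith
  qed
qed (use assms in auto)

text \<open>The hypothesis bounds the functional \<open>c\<close> on the unit ball of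
  \<open>N\<close>, so the \<open>SUP\<close> in \<open>dual_norm\<close> is meaningful; the last
  claim follows by normalizing \<open>x\<close>.\<close>

lemma dual_norm_bounds:
  fixes c :: "'a::euclidean_space"
  assumes N: "is_norm N" and c: "\<And>x. c \<bullet> x \<le> L * N x"
  shows "0 \<le> dual_norm N c" "dual_norm N c \<le> L" "c \<bullet> x \<le> dual_norm N c * N x"
proof -
  \<comment> \<open>A nonzero vector tested with both signs forces \<open>0 \<le> L\<close>.\<close>
  obtain i :: 'a where i: "i \<in> Basis" using nonempty_Basis by blast
  have "c \<bullet> i \<le> L * N i" "c \<bullet> (- i) \<le> L * N i"
    using c[of i] c[of "-i"] is_norm_minus[OF N] by simp_all
  then have "0 \<le> L * N i" by simp
  moreover have "0 < N i" using i by (intro is_norm_pos[OF N]) auto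
  ultimately have L: "0 \<le> L" by (simp add: zero_le_mult_iff)
  have le: "c \<bullet> x \<le> L" if "N x \<le> 1" for x
    using c[of x] mult_left_mono[OF that L] by simp
  have bdd: "bdd_above ((\<lambda>x. c \<bullet> x) ` {x. N x \<le> 1})" using le by (auto intro!: bdd_aboveI)
  show "dual_norm N c \<le> L"
    unfolding dual_norm_def
  proof (rule cSUP_least)
    show "{x. N x \<le> 1} \<noteq> {}" using is_norm_zero[OF N] by (metis (mono_tags) empty_iff mem_Collect_eq zero_le_one)
  qed (use le in auto)
  have up: "c \<bullet> x \<le> dual_norm N c" if "N x \<le> 1" for x
    unfolding dual_norm_def using that by (intro cSUP_upper bdd) auto
  show "0 \<le> dual_norm N c" using up[of 0] N by simp
  show "c \<bullet> x \<le> dual_norm N c * N x"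
  proof (cases "x = 0")
    case False
    then have p: "0 < N x" by (rule is_norm_pos[OF N])
    have "N (inverse (N x) *\<^sub>R x) \<le> 1" using p by (simp add: is_norm_scaleR[OF N])
    from up[OF this] p show ?thesis by (simp add: field_simps)
  qed (use N in simp)
qed

section \<open>One-sided derivatives and gradients on convex sets\<close>

text \<open>At a boundary point the line may leave \<open>X\<close> on one side. Convexity keeps the
  segment to \<open>x + d\<close> inside, and the chain rule along it gives the one-sided
  limit.\<close>

lemma has_derivative_within_directional:
  fixes f :: "'a::real_inner \<Rightarrow> real"
  assumes "(f has_derivative (\<lambda>h. g \<bullet> h)) (at x within X)" "convex X" "x \<in> X" "x + d \<in> X"
  shows "((\<lambda>\<epsilon>. (f (x + \<epsilon> *\<^sub>R d) - f x) / \<epsilon>) \<longlongrightarrow> g \<bullet> d) (at_right 0)"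
proof -
  have seg: "x + \<epsilon> *\<^sub>R d \<in> X" if "0 \<le> \<epsilon>" "\<epsilon> \<le> 1" for \<epsilon>
    using convexD_alt[OF assms(2,3,4) that] by (simp add: algebra_simps)
  have 1: "((\<lambda>\<epsilon>. x + \<epsilon> *\<^sub>R d) has_derivative (\<lambda>\<epsilon>. \<epsilon> *\<^sub>R d)) (at 0 within {0..1})"
    by (auto intro!: derivative_eq_intros)
  have 2: "(f has_derivative (\<lambda>h. g \<bullet> h)) (at (x + 0 *\<^sub>R d) within (\<lambda>\<epsilon>. x + \<epsilon> *\<^sub>R d) ` {0..1})"
    using assms(1) seg by (auto intro: has_derivative_subset)
  have "((\<lambda>\<epsilon>. f (x + \<epsilon> *\<^sub>R d)) has_derivative (\<lambda>\<epsilon>. g \<bullet> (\<epsilon> *\<^sub>R d))) (at 0 within {0..1})"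
    using has_derivative_in_compose[OF 1 2] by simp
  then have "((\<lambda>\<epsilon>. f (x + \<epsilon> *\<^sub>R d)) has_real_derivative g \<bullet> d) (at 0 within {0..1})"
    by (simp add: has_field_derivative_def mult_commute_abs)
  then show ?thesis
    by (simp add: has_field_derivative_iff at_within_Icc_at_right)
qed

text \<open>Every direction is a difference of two directions pointing from \<open>x\<close> into the interior
  of \<open>X\<close>, so a Lipschitz bound on \<open>X\<close> controls the gradient even at boundary points.\<close>

lemma lipschitz_imp_gradient_bound:
  fixes f :: "'a::euclidean_space \<Rightarrow> real"
  assumes N: "is_norm N" and X: "convex X" "interior X \<noteq> {}" "x \<in> X"
    and lip: "lipschitz_wrt N X L f"
    and der: "(f has_derivative (\<lambda>h. g \<bullet> h)) (at x within X)"
  shows "g \<bullet> u \<le> L * N u"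
proof -
  obtain p r where p: "0 < r" "ball p r \<subseteq> X" using X(2) by (auto simp: mem_interior)
  \<comment> \<open>The denominator is positive even for \<open>u = 0\<close> and makes
    \<open>\<delta> *\<^sub>R u\<close> shorter than \<open>r\<close>, so that
    \<open>p + \<delta> *\<^sub>R u\<close> stays in the ball.\<close>
  define \<delta> where "\<delta> = r / (norm u + 1)"
  have nu: "0 < norm u + 1" using norm_ge_zero[of u] by linarith
  have \<delta>: "0 < \<delta>" using p nu by (simp add: \<delta>_def)
  have "\<delta> * norm u < \<delta> * (norm u + 1)" using \<delta> by (intro mult_strict_left_mono) auto
  then have "norm (\<delta> *\<^sub>R u) < r" using \<delta> nu p by (simp add: \<delta>_def)
  then have pu: "p + \<delta> *\<^sub>R u \<in> X" and pX: "p \<in> X" using p by (auto simp: subset_iff dist_norm)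
  define d e where "d = p - x" and "e = p + \<delta> *\<^sub>R u - x"
  have dX: "x + d \<in> X" and eX: "x + e \<in> X" using pu pX by (simp_all add: d_def e_def)
  note lim = has_derivative_within_directional[OF der X(1,3)]
  have "((\<lambda>\<epsilon>. (f (x + \<epsilon> *\<^sub>R e) - f x) / \<epsilon> - (f (x + \<epsilon> *\<^sub>R d) - f x) / \<epsilon>)
      \<longlongrightarrow> g \<bullet> e - g \<bullet> d) (at_right 0)"
    by (intro tendsto_diff lim dX eX)
  moreover have "\<forall>\<^sub>F \<epsilon> in at_right (0::real).
      (f (x + \<epsilon> *\<^sub>R e) - f x) / \<epsilon> - (f (x + \<epsilon> *\<^sub>R d) - f x) / \<epsilon> \<le> L * N (\<delta> *\<^sub>R u)"
  proof (rule eventually_at_rightI[of 0 1])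
    fix \<epsilon> :: real assume \<epsilon>: "\<epsilon> \<in> {0<..<1}"
    have in_X: "x + \<epsilon> *\<^sub>R w \<in> X" if "x + w \<in> X" for w
      using convexD_alt[OF X(1,3) that, of \<epsilon>] \<epsilon> by (simp add: algebra_simps)
    have "x + \<epsilon> *\<^sub>R e - (x + \<epsilon> *\<^sub>R d) = \<epsilon> *\<^sub>R (\<delta> *\<^sub>R u)"
      by (simp add: d_def e_def algebra_simps)
    then have "N (x + \<epsilon> *\<^sub>R e - (x + \<epsilon> *\<^sub>R d)) = \<epsilon> * N (\<delta> *\<^sub>R u)"
      using \<epsilon> is_norm_scaleR[OF N, of \<epsilon> "\<delta> *\<^sub>R u"] by simp
    then have "f (x + \<epsilon> *\<^sub>R e) - f (x + \<epsilon> *\<^sub>R d) \<le> L * (\<epsilon> * N (\<delta> *\<^sub>R u))"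
      using lip in_X[OF dX] in_X[OF eX] unfolding lipschitz_wrt_def by (metis abs_le_D1)
    then show "(f (x + \<epsilon> *\<^sub>R e) - f x) / \<epsilon> - (f (x + \<epsilon> *\<^sub>R d) - f x) / \<epsilon> \<le> L * N (\<delta> *\<^sub>R u)"
      using \<epsilon> by (simp add: field_simps)
  qed simp
  ultimately have "g \<bullet> e - g \<bullet> d \<le> L * N (\<delta> *\<^sub>R u)"
    by (rule tendsto_upperbound) simp
  then have "\<delta> * (g \<bullet> u) \<le> \<delta> * (L * N u)"
    using \<delta> by (simp add: d_def e_def inner_simps is_norm_scaleR[OF N] algebra_simps)
  then show ?thesis using \<delta> by simp
qed

text \<open>Existence comes from the adjoint of the derivative. For uniqueness, the difference of
  two candidates is a gradient of the zero function, which is Lipschitz with constant 0, so the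
  preceding bound makes it vanish.\<close>

lemma has_derivative_gradient:
  fixes f :: "'a::euclidean_space \<Rightarrow> real"
  assumes X: "convex X" "interior X \<noteq> {}" "x \<in> X" and "f differentiable_on X"
  shows "(f has_derivative (\<lambda>h. gradient X f x \<bullet> h)) (at x within X)"
proof -
  obtain f' where f': "(f has_derivative f') (at x within X)"
    using assms by (auto simp: differentiable_on_def differentiable_def)
  have "linear f'" using f' by (simp add: has_derivative_bounded_linear bounded_linear.linear)
  define g where "g = adjoint f' 1"
  have "f' h = g \<bullet> h" for h
    using adjoint_works[OF \<open>linear f'\<close>, of h 1] by (simp add: g_def inner_commute)
  then have g: "(f has_derivative (\<lambda>h. g \<bullet> h)) (at x within X)"
    using f' by (metis (no_types, lifting) ext)
  have "\<exists>!g. (f has_derivative (\<lambda>h. g \<bullet> h)) (at x within X)"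
  proof (rule ex1I[of _ g])
    fix g2 assume g2: "(f has_derivative (\<lambda>h. g2 \<bullet> h)) (at x within X)"
    have "((\<lambda>y. f y - f y) has_derivative (\<lambda>h. g2 \<bullet> h - g \<bullet> h)) (at x within X)"
      by (rule has_derivative_diff[OF g2 g])
    then have "((\<lambda>y. 0) has_derivative (\<lambda>h. (g2 - g) \<bullet> h)) (at x within X)"
      by (simp add: inner_diff_left)
    from lipschitz_imp_gradient_bound[OF is_norm_norm X _ this, of 0 "g2 - g"]
    have "(g2 - g) \<bullet> (g2 - g) \<le> 0" by (simp add: lipschitz_wrt_def)
    then show "g2 = g" by (metis eq_iff_diff_eq_0 inner_eq_zero_iff inner_ge_zero order_antisym)
  qed (rule g)
  then show ?thesis unfolding gradient_def by (rule theI')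
qed

text \<open>Convexity bounds every difference quotient on the segment from \<open>x\<close> to
  \<open>y\<close> by \<open>f y - f x\<close>, and the one-sided limit inherits the bound.\<close>

lemma convex_on_gradient_ineq:
  fixes f :: "'a::euclidean_space \<Rightarrow> real"
  assumes f: "convex_on X f" and X: "interior X \<noteq> {}" and "f differentiable_on X"
    and x: "x \<in> X" and y: "y \<in> X"
  shows "gradient X f x \<bullet> (y - x) \<le> f y - f x"
proof (rule tendsto_upperbound)
  have X': "convex X" using f by (rule convex_on_imp_convex)
  show "((\<lambda>\<epsilon>. (f (x + \<epsilon> *\<^sub>R (y - x)) - f x) / \<epsilon>) \<longlongrightarrow> gradient X f x \<bullet> (y - x)) (at_right 0)"
    by (rule has_derivative_within_directional[OF has_derivative_gradient]) (use assms X' in auto)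
  show "\<forall>\<^sub>F \<epsilon> in at_right 0. (f (x + \<epsilon> *\<^sub>R (y - x)) - f x) / \<epsilon> \<le> f y - f x"
  proof (rule eventually_at_rightI[of 0 1])
    fix \<epsilon> :: real assume \<epsilon>: "\<epsilon> \<in> {0<..<1}"
    have "f ((1 - \<epsilon>) *\<^sub>R x + \<epsilon> *\<^sub>R y) \<le> (1 - \<epsilon>) * f x + \<epsilon> * f y"
      using \<epsilon> by (intro convex_onD[OF f] x y) auto
    moreover have "(1 - \<epsilon>) *\<^sub>R x + \<epsilon> *\<^sub>R y = x + \<epsilon> *\<^sub>R (y - x)" by (simp add: algebra_simps)
    ultimately have "f (x + \<epsilon> *\<^sub>R (y - x)) - f x \<le> \<epsilon> * (f y - f x)" by (simp add: algebra_simps)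
    then show "(f (x + \<epsilon> *\<^sub>R (y - x)) - f x) / \<epsilon> \<le> f y - f x"
      using \<epsilon> by (simp add: field_simps)
  qed simp
qed simp

section \<open>Power sums and scalar recursions\<close>

lemma powr_le_one:
  fixes x :: real
  assumes "1 \<le> x" "e \<le> 0"
  shows "x powr e \<le> 1"
  using powr_mono[OF assms(2,1)] assms by simp

text \<open>Comparison with the integral of \<open>z powr (- b)\<close>: the mean value theorem
  bounds each new term by an increment of the antiderivative. This is the source of the curvature
  term in the algorithm.\<close>

lemma sum_powr_minus_le:
  assumes "0 \<le> b" "b < 1" "1 \<le> t"
  shows "(\<Sum>i=1..t. real i powr (- b)) \<le> real t powr (1 - b) / (1 - b)"
  using assms(3)
proof (induction t rule: dec_induct)
  case base
  then show ?case using assms by simp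
next
  case (step t)
  have t: "0 < real t" using step by simp
  have "\<exists>z. real t < z \<and> z < real (Suc t) \<and>
      real (Suc t) powr (1 - b) - real t powr (1 - b)
        = (real (Suc t) - real t) * ((1 - b) * z powr (1 - b - 1))"
  proof (rule MVT2)
    show "((\<lambda>z. z powr (1 - b)) has_real_derivative (1 - b) * z powr (1 - b - 1)) (at z)"
      if "real t \<le> z" for z
      by (rule has_real_derivative_powr) (use t that in linarith)
  qed simp
  then obtain z where z: "real t < z" "z < real (Suc t)"
    "real (Suc t) powr (1 - b) - real t powr (1 - b) = (1 - b) * z powr (- b)"
    by auto
  have "real (Suc t) powr (- b) \<le> z powr (- b)"
    using z t assms by (intro powr_mono2') auto
  then have "(1 - b) * real (Suc t) powr (- b) \<le> real (Suc t) powr (1 - b) - real t powr (1 - b)"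
    unfolding z(3) using assms by (intro mult_left_mono) auto
  then have "real (Suc t) powr (- b)
      \<le> real (Suc t) powr (1 - b) / (1 - b) - real t powr (1 - b) / (1 - b)"
    using assms by (simp add: pos_le_divide_eq mult.commute flip: diff_divide_distrib)
  then show ?case using step by simp
qed

lemma sum_powr_minus_ge:
  assumes "0 \<le> s"
  shows "real t powr (1 - s) \<le> (\<Sum>i=1..t. real i powr (- s))"
proof (cases "t = 0")
  case False
  have "real t powr (1 - s) = (\<Sum>i=1..t. real t powr (- s))"
    using False by (simp add: powr_diff powr_minus field_simps)
  also have "\<dots> \<le> (\<Sum>i=1..t. real i powr (- s))"
    using assms by (intro sum_mono powr_mono2') auto
  finally show ?thesis .
qed simp

text \<open>Here \<open>\<delta>\<close> is a gap and \<open>n\<close> the distance to the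
  minimizer. With \<open>r = g\<^sup>2 / (2 * a)\<close>, quadratic growth turns
  \<open>g * n\<close> into at most \<open>2 * sqrt (r * \<delta>)\<close>; completing the square in
  \<open>sqrt \<delta>\<close> and solving gives the second entry of the minimum in
  \<open>h_strong\<close>.\<close>

lemma quadratic_gap_bound:
  fixes a g n \<delta> \<phi> :: real
  assumes "0 < a" "0 \<le> g" "0 \<le> n" "0 \<le> \<phi>" "\<delta> \<le> \<phi> + g * n" "a / 2 * n\<^sup>2 \<le> \<delta>"
  shows "\<delta> \<le> \<phi> + (g\<^sup>2 / a + 2 * sqrt (g\<^sup>2 / (2 * a) * (g\<^sup>2 / (2 * a) + \<phi>)))"
proof -
  define r where "r = g\<^sup>2 / (2 * a)"
  have r: "0 \<le> r" using assms by (simp add: r_def)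
  have "0 \<le> a / 2 * n\<^sup>2" using assms by simp
  then have \<delta>: "0 \<le> \<delta>" using assms by linarith
  have "(g * n)\<^sup>2 = 4 * r * (a / 2 * n\<^sup>2)"
    using assms by (simp add: r_def field_simps power2_eq_square)
  also have "\<dots> \<le> 4 * r * \<delta>" using r assms by (intro mult_left_mono) auto
  also have "\<dots> = (2 * (sqrt r * sqrt \<delta>))\<^sup>2" using r \<delta> by (simp add: power_mult_distrib)
  finally have "g * n \<le> 2 * (sqrt r * sqrt \<delta>)"
    by (rule power2_le_imp_le) (use r \<delta> in simp)
  then have "(sqrt \<delta> - sqrt r)\<^sup>2 \<le> r + \<phi>"
    using assms r \<delta> by (simp add: power2_diff mult_ac)
  then have "sqrt \<delta> - sqrt r \<le> sqrt (r + \<phi>)" by (rule real_le_rsqrt)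
  then have "(sqrt \<delta>)\<^sup>2 \<le> (sqrt r + sqrt (r + \<phi>))\<^sup>2"
    using \<delta> by (intro power_mono) auto
  then have "\<delta> \<le> r + (r + \<phi>) + 2 * (sqrt r * sqrt (r + \<phi>))"
    using r \<delta> assms by (simp add: power2_sum)
  moreover have "g\<^sup>2 / a = 2 * r" by (simp add: r_def)
  ultimately show ?thesis by (simp add: r_def[symmetric] real_sqrt_mult)
qed

text \<open>The constants are chosen such that, with \<open>k = K + 1\<close> and \<open>d = c K / k\<close>, this reduces to
  \<open>l\<^sup>2 + 2 l A \<le> ((2 k + 1) l + d)\<^sup>2\<close>, where the terms \<open>l\<^sup>2\<close> cancel by \<open>(2 k + 1)\<^sup>2 = 1 + 4 k (k + 1)\<close>.\<close>

lemma strong_step: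
  fixes K l c w u \<phi> q A :: real
  assumes K: "1 \<le> K" and A: "A = 2 * ((K + 1) * (K + 2) * l + c * K)"
    and nonneg: "0 \<le> l" "0 \<le> c" "0 \<le> u" "0 \<le> \<phi>" "0 \<le> q" and w: "0 < w" "w \<le> 1"
    and \<phi>: "\<phi> \<le> (A * u + c * w * u) / (1 + w / K)" and q: "q \<le> l * w\<^sup>2 * u"
  shows "\<phi> + (q + 2 * sqrt (q / 2 * (q / 2 + \<phi>))) \<le> A * u"
proof -
  define k where "k = K + 1"
  define d where "d = c * K / k"
  have k: "0 < k" using K by (simp add: k_def)
  have d: "0 \<le> d" "c * K = d * k" using K nonneg k by (simp_all add: d_def)
  have A': "A = 2 * (k * (k + 1) * l + d * k)" using A d by (simp add: k_def add.assoc)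
  define Z where "Z = ((2 * k + 1) * l + d) / 2"
  have Z: "0 \<le> Z" using d nonneg k by (simp add: Z_def)
  \<comment> \<open>Exactly the slack in the next inequality, multiplied by 4 and expanded.\<close>
  have "0 \<le> 2 * l * d + d\<^sup>2" using d nonneg by simp
  then have Z2: "l / 2 * (l / 2 + A) \<le> Z\<^sup>2"
    unfolding A' Z_def by (simp add: power2_eq_square field_simps)
  have A0: "0 \<le> A" using A' k d nonneg by simp
  have pos: "0 < 1 + w / K" using w K by (simp add: add_pos_nonneg)
  define M where "M = (A * u + c * w * u) / (1 + w / K)"
  \<comment> \<open>Dividing by \<open>1 + w / K\<close> must save enough to pay for the linear term
    (\<open>l\<close>) and the root (\<open>2 * Z\<close>). It does because
    \<open>K + w \<le> k\<close> and \<open>(l + 2 * Z) * k = A - c * K\<close>.\<close>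
  have M: "M + w * u * (l + 2 * Z) \<le> A * u"
  proof -
    have "(l + 2 * Z) * (K + w) \<le> (l + 2 * Z) * k"
      using Z nonneg w by (intro mult_left_mono) (auto simp: k_def)
    also have "\<dots> = A - c * K" unfolding d A' Z_def by (simp add: algebra_simps)
    finally have "(l + 2 * Z) * (K + w) / K \<le> (A - c * K) / K"
      using K by (intro divide_right_mono) auto
    then have "(l + 2 * Z) * (1 + w / K) \<le> A / K - c"
      using K by (simp add: diff_divide_distrib add_divide_distrib distrib_left)
    then have "w * u * ((l + 2 * Z) * (1 + w / K)) \<le> w * u * (A / K - c)"
      using w nonneg by (intro mult_left_mono) auto
    then have "A * u + c * w * u \<le> (A * u - w * u * (l + 2 * Z)) * (1 + w / K)"
      by (simp add: algebra_simps)
    then have "M \<le> A * u - w * u * (l + 2 * Z)"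
      unfolding M_def using pos by (simp add: pos_divide_le_eq)
    then show ?thesis by simp
  qed
  have \<phi>M: "\<phi> \<le> M" using \<phi> by (simp add: M_def)
  have "0 \<le> w * u * (l + 2 * Z)" using w nonneg Z by simp
  then have \<phi>A: "\<phi> \<le> A * u" using M \<phi>M by linarith
  \<comment> \<open>As \<open>w \<le> 1\<close>, \<open>q\<close> is bounded at three scales: with
    \<open>w\<^sup>2\<close> for one factor under the root, with \<open>1\<close> for the other, and
    with \<open>w\<close> for the linear term.\<close>
  have w2: "w\<^sup>2 \<le> w" using w by (simp add: power2_eq_square mult_left_le)
  have qw: "q \<le> w * u * l"
    using q mult_left_mono[OF w2, of "l * u"] nonneg by (simp add: mult_ac)
  have qu: "q \<le> l * u" using qw mult_right_mono[OF w(2), of "l * u"] nonneg by (simp add: mult_ac)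
  have "q / 2 * (q / 2 + \<phi>) \<le> (l * w\<^sup>2 * u) / 2 * (l * u / 2 + A * u)"
    using q qu \<phi>A nonneg by (intro mult_mono) auto
  also have "\<dots> = (w * u)\<^sup>2 * (l / 2 * (l / 2 + A))"
    by (simp add: power2_eq_square algebra_simps)
  also have "\<dots> \<le> (w * u)\<^sup>2 * Z\<^sup>2" using Z2 by (rule mult_left_mono) simp
  also have "\<dots> = (w * u * Z)\<^sup>2" by (simp add: power_mult_distrib)
  finally have "sqrt (q / 2 * (q / 2 + \<phi>)) \<le> w * u * Z"
    by (intro real_le_lsqrt) (use w nonneg Z in auto)
  then have "\<phi> + (q + 2 * sqrt (q / 2 * (q / 2 + \<phi>))) \<le> M + w * u * (l + 2 * Z)"
    using \<phi>M qw by (simp add: algebra_simps)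
  then show ?thesis using M by linarith
qed

section \<open>Accumulated losses over the polytope\<close>

text \<open>\<open>P\<close> may be lower-dimensional, so gradients are taken in a larger domain
  \<open>X\<close>, whose nonempty interior makes them unique.\<close>

locale lazy_ocg =
  fixes N :: "'a::euclidean_space \<Rightarrow> real" and P X :: "'a set" and f :: "nat \<Rightarrow> 'a \<Rightarrow> real"
    and K L C b :: real
  assumes polytope: "polytope P" and N: "is_norm N"
    and b: "0 \<le> b" "b < 1" and K: "1 \<le> K"
    and PX: "P \<subseteq> X" and interior: "interior X \<noteq> {}"
    and convex_f: "\<And>t. 1 \<le> t \<Longrightarrow> convex_on X (f t)"
    and diff_f: "\<And>t. 1 \<le> t \<Longrightarrow> f t differentiable_on X"
    and lipschitz_f: "\<And>t. 1 \<le> t \<Longrightarrow> lipschitz_wrt N X L (f t)"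
    and smooth_f: "\<And>t. 1 \<le> t \<Longrightarrow> smooth_with_curvature X P (C * real t powr (- b)) (f t)"
begin

abbreviation D :: real where "D \<equiv> norm_diameter N P"

abbreviation grad :: "nat \<Rightarrow> 'a \<Rightarrow> 'a" where "grad t \<equiv> gradient X (f t)"

definition F :: "nat \<Rightarrow> 'a \<Rightarrow> real" where "F t z = (\<Sum>i=1..t. f i z)"

definition G :: "nat \<Rightarrow> 'a \<Rightarrow> 'a" where "G t z = (\<Sum>i=1..t. grad i z)"

text \<open>Quantifying over all of \<open>P\<close> avoids naming the minimizer, which changes with
  \<open>t\<close>.\<close>

definition gap_le :: "nat \<Rightarrow> 'a \<Rightarrow> real \<Rightarrow> bool" where
  "gap_le t y r \<longleftrightarrow> (\<forall>z\<in>P. F t y - F t z \<le> r)"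

lemma F_Suc: "F (t + 1) z = F t z + f (t + 1) z"
  by (simp add: F_def)

lemma convex_P: "convex P"
  using polytope by (rule polytope_imp_convex)

lemma convex_X: "convex X"
  using convex_f[of 1] by (auto intro: convex_on_imp_convex)

lemma diameter_upper: "x \<in> P \<Longrightarrow> y \<in> P \<Longrightarrow> N (x - y) \<le> D"
  by (rule norm_diameter_upper[OF N polytope_imp_bounded[OF polytope]])

lemma grad_inner_le: "1 \<le> t \<Longrightarrow> x \<in> P \<Longrightarrow> grad t x \<bullet> u \<le> L * N u"
  using PX
  by (intro lipschitz_imp_gradient_bound[OF N convex_X interior _ lipschitz_f, of x t]
      has_derivative_gradient convex_X interior diff_f) auto

lemmas dual_norm_grad = dual_norm_bounds[OF N grad_inner_le]

lemma grad_ineq: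
  assumes "1 \<le> t" "x \<in> P" "y \<in> P"
  shows "f t x - f t y \<le> grad t x \<bullet> (x - y)"
proof -
  have "grad t x \<bullet> (y - x) \<le> f t y - f t x"
    using assms PX by (intro convex_on_gradient_ineq convex_f interior diff_f) auto
  then show ?thesis by (simp add: inner_diff_right)
qed

lemma f_diff_le:
  assumes "1 \<le> t" "x \<in> P" "y \<in> P"
  shows "f t x - f t y \<le> dual_norm N (grad t x) * N (x - y)"
  using grad_ineq[OF assms] dual_norm_grad(3)[OF assms(1,2), of "x - y"] by linarith

lemma f_diff_le_diameter:
  assumes "1 \<le> t" "x \<in> P" "y \<in> P"
  shows "f t x - f t y \<le> dual_norm N (grad t x) * D"
  using f_diff_le[OF assms] mult_left_mono[OF diameter_upper[OF assms(2,3)] dual_norm_grad(1)[OF assms(1,2)]]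
  by linarith

lemma F_gradient_ineq:
  assumes "x \<in> P" "y \<in> P"
  shows "F t x - F t y \<le> G t x \<bullet> (x - y)"
proof -
  have "(\<Sum>i=1..t. f i x - f i y) \<le> (\<Sum>i=1..t. grad i x \<bullet> (x - y))"
    using assms by (intro sum_mono grad_ineq) auto
  then show ?thesis by (simp add: F_def G_def sum_subtractf inner_sum_left)
qed

text \<open>At \<open>t = 1\<close>, with both points equal and step 1, the curvature inequality
  collapses to \<open>0 \<le> C / 2\<close>.\<close>

lemma C_nonneg: "x \<in> P \<Longrightarrow> 0 \<le> C"
  using smooth_f[of 1, unfolded smooth_with_curvature_def, rule_format, of x x 1] by simp

lemma L_nonneg: "x \<in> P \<Longrightarrow> 0 \<le> L"
  using dual_norm_grad(1,2)[of 1 x] by simp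

lemma F_smooth:
  assumes x: "x \<in> P" and y: "y \<in> P" and \<gamma>: "0 \<le> \<gamma>" "\<gamma> \<le> 1" and t: "1 \<le> t"
  shows "F t ((1 - \<gamma>) *\<^sub>R x + \<gamma> *\<^sub>R y)
    \<le> F t x - \<gamma> * (G t x \<bullet> (x - y)) + C * real t powr (1 - b) * \<gamma>\<^sup>2 / (2 * (1 - b))"
proof -
  have "f i (\<gamma> *\<^sub>R y + (1 - \<gamma>) *\<^sub>R x)
      \<le> f i x + \<gamma> * (grad i x \<bullet> (y - x)) + (C * \<gamma>\<^sup>2 / 2) * real i powr (- b)" if "1 \<le> i" for i
    using smooth_f[OF that] x y \<gamma> unfolding smooth_with_curvature_def
    by (fastforce simp: mult_ac)
  then have "F t (\<gamma> *\<^sub>R y + (1 - \<gamma>) *\<^sub>R x)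
      \<le> (\<Sum>i=1..t. f i x + \<gamma> * (grad i x \<bullet> (y - x)) + (C * \<gamma>\<^sup>2 / 2) * real i powr (- b))"
    unfolding F_def by (intro sum_mono) auto
  also have "\<dots> = F t x + \<gamma> * (G t x \<bullet> (y - x)) + (C * \<gamma>\<^sup>2 / 2) * (\<Sum>i=1..t. real i powr (- b))"
    by (simp only: sum.distrib F_def G_def inner_sum_left sum_distrib_left)
  also have "(C * \<gamma>\<^sup>2 / 2) * (\<Sum>i=1..t. real i powr (- b))
      \<le> (C * \<gamma>\<^sup>2 / 2) * (real t powr (1 - b) / (1 - b))"
    using C_nonneg[OF x] by (intro mult_left_mono sum_powr_minus_le b t) auto
  finally show ?thesis by (simp add: inner_diff_right algebra_simps)
qed

section \<open>The run of the algorithm and its gap invariants\<close>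

lemma run_in_P:
  assumes run: "lazy_ocg_run N X P f K C b \<gamma> H T x \<Phi>"
    and \<gamma>: "\<And>t. 1 \<le> t \<Longrightarrow> 0 \<le> \<gamma> t \<and> \<gamma> t \<le> 1"
    and "1 \<le> t" "t \<le> T"
  shows "x t \<in> P"
  using assms(3,4)
proof (induction t rule: dec_induct)
  case base
  then show ?case using run by (simp add: lazy_ocg_run_def extreme_point_of_def)
next
  case (step t)
  then have "x t \<in> P" "t \<in> {1..<T}" by auto
  moreover obtain v where "case v of
      None \<Rightarrow> x (t + 1) = x t
    | Some y \<Rightarrow> y \<in> P \<and> x (t + 1) = (1 - \<gamma> t) *\<^sub>R x t + \<gamma> t *\<^sub>R y"
    using run \<open>t \<in> {1..<T}\<close> unfolding lazy_ocg_run_def LPsep_answer_def Let_def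
    by (fastforce simp: extreme_point_of_def split: option.splits)
  ultimately show ?case
    using convexD_alt[OF convex_P] \<gamma>[of t] by (auto split: option.splits)
qed

text \<open>Common analysis for both rules: \<open>H1\<close> and \<open>HS\<close> say that
  \<open>H\<close> yields valid gap bounds, \<open>B1\<close> and \<open>BS\<close> that
  \<open>B\<close> solves the resulting recursion.\<close>

theorem regret_bound:
  assumes run: "lazy_ocg_run N X P f K C b \<gamma> H T x \<Phi>" and T: "1 \<le> T"
    and \<gamma>: "\<And>t. 1 \<le> t \<Longrightarrow> 0 \<le> \<gamma> t \<and> \<gamma> t \<le> 1"
    and H1: "\<And>y \<phi>. y \<in> P \<Longrightarrow> gap_le 1 y (H 1 (dual_norm N (grad 1 y)) \<phi>)"
    and HS: "\<And>t y \<phi>. 1 \<le> t \<Longrightarrow> y \<in> P \<Longrightarrow> gap_le t y \<phi> \<Longrightarrow>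
      gap_le (t + 1) y (H (t + 1) (dual_norm N (grad (t + 1) y)) \<phi>)"
    and B1: "\<And>g \<phi>. 0 \<le> g \<Longrightarrow> g \<le> L \<Longrightarrow> H 1 g \<phi> \<le> B 1"
    and BS: "\<And>t g \<phi>. 1 \<le> t \<Longrightarrow> 0 \<le> g \<Longrightarrow> g \<le> L \<Longrightarrow> 0 \<le> \<phi> \<Longrightarrow>
      \<phi> \<le> (B t + C * real t powr (1 - b) * (\<gamma> t)\<^sup>2 / (2 * (1 - b))) / (1 + \<gamma> t / K) \<Longrightarrow>
      H (t + 1) g \<phi> \<le> B (t + 1)"
  shows "gap_le T (x T) (B T)"
proof -
  define h where "h t = H t (dual_norm N (grad t (x t))) (\<Phi> (t - 1))" for t
  define q where "q t = C * real t powr (1 - b) * (\<gamma> t)\<^sup>2 / (2 * (1 - b))" for t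
  define \<Phi>' where "\<Phi>' t = (h t + q t) / (1 + \<gamma> t / K)" for t
  note in_P = run_in_P[OF run \<gamma>]
  have "gap_le t (x t) (h t) \<and> h t \<le> B t" if "1 \<le> t" "t \<le> T" for t
    using that
  proof (induction t rule: dec_induct)
    \<comment> \<open>\<open>\<Phi> 0\<close> is unconstrained, hence the arbitrary
      \<open>\<phi>\<close> in \<open>H1\<close> and \<open>B1\<close>.\<close>
    case base
    have "x 1 \<in> P" using in_P T by simp
    then show ?case using H1[of "x 1"] B1 dual_norm_grad(1,2)[of 1 "x 1"] by (simp add: h_def)
  next
    case (step t)
    then have IH: "x t \<in> P" "gap_le t (x t) (h t)" "h t \<le> B t" and t: "1 \<le> t" "t < T"
      using in_P by auto
    have x': "x (t + 1) \<in> P" using in_P t by simp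
    note \<gamma>t = \<gamma>[OF t(1)]
    have pos: "0 < 1 + \<gamma> t / K" using \<gamma>t K by (simp add: add_pos_nonneg)
    \<comment> \<open>The value \<open>\<Phi>' t\<close> balances the two answers: progress
      \<open>\<gamma> t * (\<Phi>' t / K)\<close> takes \<open>h t + q t\<close> exactly down to
      \<open>\<Phi>' t\<close>.\<close>
    have \<Phi>'_eq: "\<Phi>' t + \<gamma> t * (\<Phi>' t / K) = h t + q t"
    proof -
      have "\<Phi>' t * (1 + \<gamma> t / K) = h t + q t" using pos by (simp add: \<Phi>'_def)
      then show ?thesis by (simp add: algebra_simps)
    qed
    have "t \<in> {1..<T}" using t by simp
    with run have "\<exists>v. LPsep_answer P (G t (x t)) (x t) (\<Phi>' t) K v \<and>
        (case v of
          None \<Rightarrow> x (t + 1) = x t \<and> \<Phi> t = \<Phi>' t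
        | Some y \<Rightarrow> x (t + 1) = (1 - \<gamma> t) *\<^sub>R x t + \<gamma> t *\<^sub>R y \<and>
            \<Phi> t = h t - F t (x t) + F t (x (t + 1)))"
      unfolding lazy_ocg_run_def Let_def G_def F_def \<Phi>'_def q_def h_def
      by (elim conjE) (drule (1) bspec)
    then obtain v where v: "LPsep_answer P (G t (x t)) (x t) (\<Phi>' t) K v"
      and v_cases: "case v of
          None \<Rightarrow> x (t + 1) = x t \<and> \<Phi> t = \<Phi>' t
        | Some y \<Rightarrow> x (t + 1) = (1 - \<gamma> t) *\<^sub>R x t + \<gamma> t *\<^sub>R y \<and>
            \<Phi> t = h t - F t (x t) + F t (x (t + 1))"
      by (elim exE conjE) (rule that)
    have "gap_le t (x (t + 1)) (\<Phi> t) \<and> \<Phi> t \<le> \<Phi>' t"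
    proof (cases v)
      case None
      have "\<forall>z\<in>P. G t (x t) \<bullet> (x t - z) \<le> \<Phi>' t"
        using v unfolding None LPsep_answer_def by simp
      then have "gap_le t (x t) (\<Phi>' t)"
        unfolding gap_le_def using F_gradient_ineq[OF IH(1)] order_trans by blast
      then show ?thesis using v_cases unfolding None by simp
    next
      case (Some y)
      have y: "y \<in> P" "\<Phi>' t / K < G t (x t) \<bullet> (x t - y)"
        using v Some by (auto simp: LPsep_answer_def extreme_point_of_def)
      have xt: "x (t + 1) = (1 - \<gamma> t) *\<^sub>R x t + \<gamma> t *\<^sub>R y"
        and \<Phi>t: "\<Phi> t = h t - F t (x t) + F t (x (t + 1))" using v_cases Some by auto
      have "gap_le t (x (t + 1)) (\<Phi> t)"
        using IH(2) by (auto simp: gap_le_def \<Phi>t)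
      moreover have "\<Phi> t \<le> \<Phi>' t"
      proof -
        have "F t (x (t + 1)) \<le> F t (x t) - \<gamma> t * (G t (x t) \<bullet> (x t - y)) + q t"
          unfolding xt q_def using \<gamma>t by (intro F_smooth IH y t) auto
        moreover have "\<gamma> t * (\<Phi>' t / K) \<le> \<gamma> t * (G t (x t) \<bullet> (x t - y))"
          using \<gamma>t y by (intro mult_left_mono) auto
        ultimately show ?thesis using \<Phi>'_eq \<Phi>t by linarith
      qed
      ultimately show ?thesis by simp
    qed
    then have S: "x (t + 1) \<in> P" "gap_le t (x (t + 1)) (\<Phi> t)" "\<Phi> t \<le> \<Phi>' t" using x' by auto
    \<comment> \<open>The gap bound is tested at \<open>x (t + 1)\<close> itself.\<close>
    have "0 \<le> \<Phi> t" using S(1,2) unfolding gap_le_def by force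
    moreover have "\<Phi> t \<le> (B t + q t) / (1 + \<gamma> t / K)"
      using S(3) IH(3) pos unfolding \<Phi>'_def
      by (meson add_right_mono divide_right_mono less_imp_le order_trans)
    ultimately have "h (t + 1) \<le> B (t + 1)"
      using BS[OF t(1)] dual_norm_grad(1,2)[of "t + 1" "x (t + 1)"] S(1) by (simp add: h_def q_def)
    then show ?case using S HS[OF t(1) S(1,2)] by (simp add: h_def)
  qed
  from this[OF T order_refl] show ?thesis by (auto simp: gap_le_def intro: order_trans)
qed

lemma average_regret:
  assumes "gap_le T y (A * real T powr e)" "z \<in> P" "1 \<le> T"
  shows "(1 / real T) * (\<Sum>t=1..T. f t y - f t z) \<le> A * real T powr (e - 1)"
proof -
  have "(\<Sum>t=1..T. f t y - f t z) \<le> A * real T powr e"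
    using assms by (simp add: gap_le_def F_def sum_subtractf)
  then have "(1 / real T) * (\<Sum>t=1..T. f t y - f t z) \<le> (1 / real T) * (A * real T powr e)"
    using assms by (intro mult_left_mono) auto
  also have "\<dots> = A * real T powr (e - 1)"
    using assms by (simp add: powr_diff)
  finally show ?thesis .
qed

section \<open>The rate without strong convexity\<close>

lemma gap_le_h_plain:
  assumes "1 \<le> t" "y \<in> P" "gap_le t y \<phi>"
  shows "gap_le (t + 1) y (h_plain D (t + 1) (dual_norm N (grad (t + 1) y)) \<phi>)"
  unfolding gap_le_def F_Suc
proof
  fix z assume z: "z \<in> P"
  show "F t y + f (t + 1) y - (F t z + f (t + 1) z)
      \<le> h_plain D (t + 1) (dual_norm N (grad (t + 1) y)) \<phi>"
    using f_diff_le_diameter[of "t + 1" y z] assms z by (auto simp: h_plain_def gap_le_def)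
qed

text \<open>The stronger rate \<open>(1 + b) / 2\<close> comes out; the stated \<open>(1 - b) / 2\<close> is weaker as \<open>b \<ge> 0\<close>.\<close>

lemma regret_plain:
  assumes run: "lazy_ocg_run N X P f K C b (\<lambda>t. real t powr (- (1 - b) / 2)) (h_plain D) T x \<Phi>"
    and T: "1 \<le> T" and z: "z \<in> P"
  shows "(1 / real T) * (\<Sum>t=1..T. f t (x T) - f t z)
    \<le> (C * K / (2 * (1 - b)) + L * (K + 1) * D) * real T powr (- (1 - b) / 2)"
proof -
  define c where "c = C / (2 * (1 - b))"
  define A where "A = c * K + L * (K + 1) * D"
  define a where "a = (1 - b) / 2"
  have a: "0 \<le> a" using b by (simp add: a_def)
  have D: "0 \<le> D" using diameter_upper[OF z z] N by simp
  have L: "0 \<le> L" and C: "0 \<le> C" using L_nonneg C_nonneg z by auto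
  have c: "0 \<le> c" using C b by (simp add: c_def)
  have LD: "0 \<le> L * D" using L D by simp
  have A_alt: "A = (c + L * D) * K + L * D" by (simp add: A_def algebra_simps)
  have A: "L * D \<le> A" unfolding A_alt using c LD K by simp
  have "gap_le T (x T) (A * real T powr a)"
  proof (rule regret_bound[OF run T, where B = "\<lambda>t. A * real t powr a"])
    fix t :: nat assume "1 \<le> t"
    then show "0 \<le> real t powr (- (1 - b) / 2) \<and> real t powr (- (1 - b) / 2) \<le> 1"
      using b by (auto intro!: powr_le_one)
  next
    fix y \<phi> assume "y \<in> P"
    then show "gap_le 1 y (h_plain D 1 (dual_norm N (grad 1 y)) \<phi>)"
      using f_diff_le_diameter[of 1 y] by (auto simp: gap_le_def h_plain_def F_def)
  next
    fix g \<phi> :: real assume "g \<le> L"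
    then have "g * D \<le> L * D" using D by (rule mult_right_mono)
    then show "h_plain D 1 g \<phi> \<le> A * real 1 powr a" using A by (simp add: h_plain_def)
  next
    fix t :: nat and g \<phi> :: real
    assume t: "1 \<le> t" and g: "g \<le> L"
      and \<phi>: "\<phi> \<le> (A * real t powr a + C * real t powr (1 - b) * (real t powr (- (1 - b) / 2))\<^sup>2
        / (2 * (1 - b))) / (1 + real t powr (- (1 - b) / 2) / K)"
    define w where "w = real t powr (- a)"
    have w: "0 < w" "w \<le> 1" using t a by (auto simp: w_def intro!: powr_le_one)
    \<comment> \<open>The step size is the reciprocal of the growth \<open>t powr a\<close> of the
      bound, so \<open>A * real t powr a * w / K\<close> is the constant \<open>A / K\<close>. The
      curvature term is constant as well, and the recursion reduces to comparing constants.\<close>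
    have wu: "w * real t powr a = 1" using t by (simp add: w_def powr_minus)
    have w': "real t powr (- (1 - b) / 2) = w" by (simp add: w_def a_def minus_divide_left)
    have "real t powr (1 - b) * w\<^sup>2 = real t powr (1 - b - a - a)"
      using t by (simp add: w_def power2_eq_square flip: powr_add)
    also have "\<dots> = 1" using t by (simp add: a_def)
    finally have "C * real t powr (1 - b) * w\<^sup>2 / (2 * (1 - b)) = c" by (simp add: c_def mult.assoc)
    then have \<phi>: "\<phi> \<le> (A * real t powr a + c) / (1 + w / K)" using \<phi> unfolding w' by simp
    have pos: "0 < 1 + w / K" using w K by (simp add: add_pos_nonneg)
    have "L * D * w \<le> L * D" using LD w by (simp add: mult_left_le)
    then have "(c + L * D) * K + L * D * w \<le> A" unfolding A_alt by simp
    then have "((c + L * D) * K + L * D * w) / K \<le> A / K"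
      using K by (intro divide_right_mono) auto
    then have "c + L * D + L * D * w / K \<le> A / K" using K by (simp add: add_divide_distrib)
    then have "A * real t powr a + c + L * D * (1 + w / K) \<le> A * (real t powr a + w * real t powr a / K)"
      unfolding wu by (simp add: algebra_simps)
    then have "A * real t powr a + c \<le> (A * real t powr a - L * D) * (1 + w / K)"
      by (simp add: algebra_simps)
    then have "(A * real t powr a + c) / (1 + w / K) \<le> A * real t powr a - L * D"
      using pos by (simp add: pos_divide_le_eq)
    moreover have "g * D \<le> L * D" using g D by (rule mult_right_mono)
    moreover have "A * real t powr a \<le> A * real (t + 1) powr a"
      using a A LD by (intro mult_left_mono powr_mono2) auto
    ultimately show "h_plain D (t + 1) g \<phi> \<le> A * real (t + 1) powr a"
      using \<phi> t by (simp add: h_plain_def)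
  qed (rule gap_le_h_plain)
  then have "(1 / real T) * (\<Sum>t=1..T. f t (x T) - f t z) \<le> A * real T powr (a - 1)"
    using z T by (intro average_regret) auto
  also have "\<dots> \<le> A * real T powr (- (1 - b) / 2)"
    using A LD T b by (intro mult_left_mono powr_mono) (auto simp: a_def field_simps)
  finally show ?thesis by (simp add: A_def c_def)
qed

section \<open>The rate under strong convexity\<close>

context
  fixes S s :: real
  assumes S: "0 < S" and s: "0 \<le> s" "s < 1"
    and strong: "\<And>t. 1 \<le> t \<Longrightarrow> strongly_convex_wrt N X P (S * real t powr (- s)) (f t)"
begin

lemma F_strongly_convex:
  assumes x: "x \<in> P" and y: "y \<in> P"
  shows "G t x \<bullet> (y - x) + S * real t powr (1 - s) / 2 * (N (y - x))\<^sup>2 \<le> F t y - F t x"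
proof -
  define n where "n = (N (y - x))\<^sup>2"
  have "S * real t powr (1 - s) / 2 * n \<le> S / 2 * n * (\<Sum>i=1..t. real i powr (- s))"
    using mult_left_mono[OF sum_powr_minus_ge[OF s(1), of t], of "S / 2 * n"] S
    by (simp add: n_def mult_ac)
  also have "G t x \<bullet> (y - x) + \<dots>
      = (\<Sum>i=1..t. grad i x \<bullet> (y - x) + S / 2 * n * real i powr (- s))"
    by (simp only: G_def inner_sum_left sum_distrib_left sum.distrib)
  also have "\<dots> \<le> (\<Sum>i=1..t. f i y - f i x)"
  proof (rule sum_mono)
    fix i assume "i \<in> {1..t}"
    then show "grad i x \<bullet> (y - x) + S / 2 * n * real i powr (- s) \<le> f i y - f i x"
      using strong[of i] x y by (auto simp: strongly_convex_wrt_def n_def mult_ac)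
  qed
  finally show ?thesis by (simp add: n_def F_def sum_subtractf)
qed

text \<open>No first-order condition at \<open>z\<close> is invoked. Strong convexity at
  \<open>m = (1 - l) *\<^sub>R z + l *\<^sub>R x\<close> is applied towards \<open>x\<close> and
  \<open>z\<close> with weights \<open>l\<close> and \<open>1 - l\<close>; the gradient terms
  cancel, and minimality gives the claim up to the factor \<open>1 - l\<close>. Then
  \<open>l\<close> tends to 0.\<close>

lemma F_quadratic_growth:
  assumes x: "x \<in> P" and z: "z \<in> P" and min: "\<And>y. y \<in> P \<Longrightarrow> F t z \<le> F t y"
  shows "S * real t powr (1 - s) / 2 * (N (x - z))\<^sup>2 \<le> F t x - F t z"
proof -
  define \<sigma> where "\<sigma> = S * real t powr (1 - s) / 2 * (N (x - z))\<^sup>2"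
  have "(1 - l) * \<sigma> \<le> F t x - F t z" if l: "0 < l" "l < 1" for l
  proof -
    define m where "m = (1 - l) *\<^sub>R z + l *\<^sub>R x"
    have m: "m \<in> P" unfolding m_def using convexD_alt[OF convex_P z x, of l] l by simp
    have xm: "x - m = (1 - l) *\<^sub>R (x - z)" and zm: "z - m = (- l) *\<^sub>R (x - z)"
      by (simp_all add: m_def algebra_simps)
    have "(1 - l) * (G t m \<bullet> (x - z)) + (1 - l)\<^sup>2 * \<sigma> \<le> F t x - F t m"
      using F_strongly_convex[OF m x, of t] unfolding xm is_norm_scaleR[OF N]
      by (simp add: \<sigma>_def power_mult_distrib mult_ac)
    from mult_left_mono[OF this, of l]
    have 1: "l * (1 - l) * (G t m \<bullet> (x - z)) + l * (1 - l)\<^sup>2 * \<sigma> \<le> l * (F t x - F t m)"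
      using l by (simp add: algebra_simps)
    have "- l * (G t m \<bullet> (x - z)) + l\<^sup>2 * \<sigma> \<le> F t z - F t m"
      using F_strongly_convex[OF m z, of t] unfolding zm is_norm_scaleR[OF N]
      by (simp add: \<sigma>_def power_mult_distrib mult_ac)
    from mult_left_mono[OF this, of "1 - l"]
    have 2: "- l * (1 - l) * (G t m \<bullet> (x - z)) + (1 - l) * l\<^sup>2 * \<sigma> \<le> (1 - l) * (F t z - F t m)"
      using l by (simp add: algebra_simps)
    have "l * (1 - l)\<^sup>2 * \<sigma> + (1 - l) * l\<^sup>2 * \<sigma> = l * ((1 - l) * \<sigma>)"
      by (simp add: power2_eq_square algebra_simps)
    then have "l * ((1 - l) * \<sigma>) \<le> l * (F t x - F t z) + (F t z - F t m)"
      using 1 2 by (simp add: algebra_simps)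
    also have "\<dots> \<le> l * (F t x - F t z)" using min[OF m] by simp
    finally show ?thesis using l by simp
  qed
  then have "\<forall>\<^sub>F l in at_right 0. (1 - l) * \<sigma> \<le> F t x - F t z"
    by (intro eventually_at_rightI[of 0 1]) auto
  moreover have "((\<lambda>l. (1 - l) * \<sigma>) \<longlongrightarrow> (1 - 0) * \<sigma>) (at_right 0)"
    by (intro tendsto_intros)
  ultimately have "(1 - 0) * \<sigma> \<le> F t x - F t z"
    by (intro tendsto_upperbound) auto
  then show ?thesis by (simp add: \<sigma>_def)
qed

lemma F_attains_min:
  assumes "P \<noteq> {}"
  obtains z where "z \<in> P" "\<And>y. y \<in> P \<Longrightarrow> F t z \<le> F t y"
proof -
  have "continuous_on P (f i)" if "1 \<le> i" for i
    using continuous_on_subset[OF differentiable_imp_continuous_on[OF diff_f[OF that]] PX] .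
  then have "continuous_on P (F t)"
    unfolding F_def by (intro continuous_intros) auto
  from continuous_attains_inf[OF polytope_imp_compact[OF polytope] assms this]
  show thesis using that by blast
qed

lemma gap_le_h_strong_1:
  assumes y: "y \<in> P"
  shows "gap_le 1 y (h_strong D S s 1 (dual_norm N (grad 1 y)) \<phi>)"
  unfolding gap_le_def
proof
  fix z assume z: "z \<in> P"
  define g where "g = dual_norm N (grad 1 y)"
  define n where "n = N (y - z)"
  have "grad 1 y \<bullet> (z - y) + S / 2 * n\<^sup>2 \<le> f 1 z - f 1 y"
    using strong[of 1] y z by (simp add: strongly_convex_wrt_def n_def is_norm_minus_commute[OF N, of y])
  moreover have "grad 1 y \<bullet> (y - z) \<le> g * n"
    using dual_norm_grad(3)[of 1 y "y - z"] y by (simp add: g_def n_def)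
  ultimately have "f 1 y - f 1 z \<le> g * n - S / 2 * n\<^sup>2" by (simp add: inner_diff_right)
  also have "\<dots> \<le> 2 * g\<^sup>2 / S"
  proof -
    \<comment> \<open>This is \<open>4 * g\<^sup>2 - 2 * S * g * n + S\<^sup>2 * n\<^sup>2\<close>,
      twice the slack in the next line.\<close>
    have "0 \<le> (g - S * n)\<^sup>2 + 3 * g\<^sup>2" by simp
    then have "S * (g * n - S / 2 * n\<^sup>2) \<le> 2 * g\<^sup>2"
      by (simp add: power2_eq_square algebra_simps)
    then show ?thesis using S by (simp add: pos_le_divide_eq mult.commute)
  qed
  finally have "f 1 y - f 1 z \<le> 2 * g\<^sup>2 / S" .
  then show "F 1 y - F 1 z \<le> h_strong D S s 1 (dual_norm N (grad 1 y)) \<phi>"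
    using f_diff_le_diameter[of 1 y z] y z by (simp add: h_strong_def F_def g_def)
qed

lemma gap_le_h_strong_Suc:
  assumes t: "1 \<le> t" and y: "y \<in> P" and gap: "gap_le t y \<phi>"
  shows "gap_le (t + 1) y (h_strong D S s (t + 1) (dual_norm N (grad (t + 1) y)) \<phi>)"
proof -
  define g where "g = dual_norm N (grad (t + 1) y)"
  define a where "a = S * real (t + 1) powr (1 - s)"
  have a: "0 < a" using S by (simp add: a_def)
  have g: "0 \<le> g" using dual_norm_grad(1)[of "t + 1" y] y by (simp add: g_def)
  have \<phi>: "0 \<le> \<phi>" using gap y by (force simp: gap_le_def)
  \<comment> \<open>Quadratic growth holds around a minimizer, and the gap measured there dominates
    the gap to every other point.\<close>
  obtain z where z: "z \<in> P" and min: "\<And>w. w \<in> P \<Longrightarrow> F (t + 1) z \<le> F (t + 1) w"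
    using F_attains_min[of "t + 1"] y by blast
  have gapz: "F t y - F t z \<le> \<phi>" using gap z by (simp add: gap_le_def)
  have "F (t + 1) y - F (t + 1) z \<le> \<phi> + g * N (y - z)"
    using gapz f_diff_le[of "t + 1" y z] y z unfolding F_Suc g_def by simp
  moreover have "a / 2 * (N (y - z))\<^sup>2 \<le> F (t + 1) y - F (t + 1) z"
    unfolding a_def by (rule F_quadratic_growth[OF y z min])
  ultimately have "F (t + 1) y - F (t + 1) z
      \<le> \<phi> + (g\<^sup>2 / a + 2 * sqrt (g\<^sup>2 / (2 * a) * (g\<^sup>2 / (2 * a) + \<phi>)))"
    using a g \<phi> is_norm_nonneg[OF N] by (intro quadratic_gap_bound)
  moreover have "F (t + 1) y - F (t + 1) z \<le> \<phi> + g * D"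
    using gapz f_diff_le_diameter[of "t + 1" y z] y z unfolding F_Suc g_def by simp
  moreover have "h_strong D S s (t + 1) g \<phi>
      = \<phi> + min (g * D) (g\<^sup>2 / a + 2 * sqrt (g\<^sup>2 / (2 * a) * (g\<^sup>2 / (2 * a) + \<phi>)))"
    using t by (simp add: h_strong_def a_def mult.assoc)
  ultimately have "F (t + 1) y - F (t + 1) z \<le> h_strong D S s (t + 1) g \<phi>" by simp
  then show ?thesis using min unfolding gap_le_def g_def by force
qed

text \<open>Combining strong convexity with the curvature bound gives
  \<open>S t\<^bsup>-s\<^esup> \<parallel>x - y\<parallel>\<^sup>2 \<le> C t\<^bsup>-b\<^esup>\<close> for every \<open>t\<close>.\<close>

lemma curvature_exponents:
  assumes "x \<in> P" "y \<in> P" "x \<noteq> y"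
  shows "b \<le> s"
proof (rule ccontr)
  assume "\<not> b \<le> s"
  define n where "n = S * (N (y - x))\<^sup>2"
  have n: "0 < n" using is_norm_pos[OF N, of "y - x"] assms S by (simp add: n_def)
  have bound: "real t powr (b - s) \<le> C / n" if t: "1 \<le> t" for t
  proof -
    have "f t y \<le> f t x + grad t x \<bullet> (y - x) + C * real t powr (- b) / 2"
      using smooth_f[OF t, unfolded smooth_with_curvature_def, rule_format, of x y 1] assms by simp
    moreover have "f t y - f t x \<ge> grad t x \<bullet> (y - x) + S * real t powr (- s) / 2 * (N (y - x))\<^sup>2"
      using strong[OF t] assms unfolding strongly_convex_wrt_def by blast
    ultimately have "n * real t powr (- s) \<le> C * real t powr (- b)"
      by (simp add: n_def mult_ac)
    then have "n * real t powr (- s) * real t powr b \<le> C * real t powr (- b) * real t powr b"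
      by (rule mult_right_mono) simp
    then have "n * real t powr (b - s) \<le> C"
      using t by (simp add: mult.assoc add.commute flip: powr_add)
    then show ?thesis using n by (simp add: pos_le_divide_eq mult.commute)
  qed
  \<comment> \<open>If \<open>s < b\<close>, the power is unbounded, against the uniform bound
    \<open>C / n\<close>.\<close>
  have "filterlim (\<lambda>t. real t powr (b - s)) at_top sequentially"
    using \<open>\<not> b \<le> s\<close>
    by (intro filterlim_compose[OF real_powr_at_top filterlim_real_sequentially]) simp
  then have "\<forall>\<^sub>F t in sequentially. C / n < real t powr (b - s)"
    by (simp add: filterlim_at_top_dense)
  with eventually_ge_at_top[of 1] have "\<forall>\<^sub>F t :: nat in sequentially. False"
    by eventually_elim (use bound in force)
  then show False by simp
qed

text \<open>The assumption \<open>b \<le> s\<close> gives \<open>0 \<le> e\<close>, so the bound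
  \<open>A * real t powr e\<close> passes from \<open>t\<close> to \<open>t + 1\<close> by
  monotonicity.\<close>

lemma regret_strong:
  assumes run: "lazy_ocg_run N X P f K C b (\<lambda>t. real t powr ((b + s - 2) / 3)) (h_strong D S s) T x \<Phi>"
    and T: "1 \<le> T" and z: "z \<in> P" and bs: "b \<le> s"
  shows "(1 / real T) * (\<Sum>t=1..T. f t (x T) - f t z)
    \<le> 2 * ((K + 1) * (K + 2) * (L\<^sup>2 / S) + C * K / (2 * (1 - b))) * real T powr (- (2 * (1 + b) - s) / 3)"
proof -
  define c where "c = C / (2 * (1 - b))"
  define l where "l = L\<^sup>2 / S"
  define A where "A = 2 * ((K + 1) * (K + 2) * l + c * K)"
  define e where "e = (1 + s - 2 * b) / 3"
  have e: "0 \<le> e" using b bs by (simp add: e_def)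
  have L: "0 \<le> L" and C: "0 \<le> C" using L_nonneg C_nonneg z by auto
  have c: "0 \<le> c" using C b by (simp add: c_def)
  have l: "0 \<le> l" using S by (simp add: l_def)
  \<comment> \<open>Prepares \<open>2 * l \<le> A\<close>, which covers
    \<open>2 * g\<^sup>2 / S\<close> in the first iteration.\<close>
  have "1 * l \<le> (K + 1) * (K + 2) * l"
    using K l mult_mono[of 1 "K + 1" 1 "K + 2"] by (intro mult_right_mono) auto
  moreover have "0 \<le> c * K" using c K by simp
  ultimately have A: "2 * l \<le> A" by (simp add: A_def)
  have g2: "g\<^sup>2 / S \<le> l" if "0 \<le> g" "g \<le> L" for g
    unfolding l_def using that S by (intro divide_right_mono power_mono) auto
  have "gap_le T (x T) (A * real T powr e)"
  proof (rule regret_bound[OF run T, where B = "\<lambda>t. A * real t powr e"])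
    fix t :: nat assume "1 \<le> t"
    then show "0 \<le> real t powr ((b + s - 2) / 3) \<and> real t powr ((b + s - 2) / 3) \<le> 1"
      using b s by (auto intro!: powr_le_one)
  next
    fix g \<phi> :: real assume "0 \<le> g" "g \<le> L"
    then show "h_strong D S s 1 g \<phi> \<le> A * real 1 powr e"
      using A g2[of g] by (simp add: h_strong_def min_le_iff_disj)
  next
    fix t :: nat and g \<phi> :: real
    assume t: "1 \<le> t" and g: "0 \<le> g" "g \<le> L" and \<phi>0: "0 \<le> \<phi>"
      and \<phi>: "\<phi> \<le> (A * real t powr e + C * real t powr (1 - b) * (real t powr ((b + s - 2) / 3))\<^sup>2
        / (2 * (1 - b))) / (1 + real t powr ((b + s - 2) / 3) / K)"
    define w where "w = real t powr ((b + s - 2) / 3)"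
    define u where "u = real t powr e"
    define q where "q = g\<^sup>2 / (S * real (t + 1) powr (1 - s))"
    have w: "0 < w" "w \<le> 1" using t b s by (auto simp: w_def intro!: powr_le_one)
    have w2: "w\<^sup>2 = real t powr (2 * ((b + s - 2) / 3))"
      by (simp only: w_def power2_eq_square mult_2 powr_add)
    \<comment> \<open>The step exponent is chosen so that the curvature term scales as
      \<open>w * u\<close>, while the gradient term \<open>real t powr (s - 1)\<close> below scales
      as \<open>w\<^sup>2 * u\<close>, the form that \<open>strong_step\<close> expects.\<close>
    have "real t powr (1 - b) * w\<^sup>2 = w * u"
      unfolding w2 unfolding w_def u_def powr_add[symmetric]
      by (rule arg_cong[where f = "(powr) (real t)"]) (simp add: e_def field_simps)
    then have "C * real t powr (1 - b) * w\<^sup>2 / (2 * (1 - b)) = c * w * u"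
      by (simp add: c_def mult.assoc)
    then have \<phi>': "\<phi> \<le> (A * u + c * w * u) / (1 + w / K)"
      using \<phi> unfolding w_def[symmetric] u_def[symmetric] by simp
    have "real t powr (s - 1) = w\<^sup>2 * u"
      unfolding w2 unfolding u_def powr_add[symmetric]
      by (rule arg_cong[where f = "(powr) (real t)"]) (simp add: e_def field_simps)
    moreover have "q = g\<^sup>2 / S * real (t + 1) powr (s - 1)"
      using powr_minus_divide[of "real (t + 1)" "1 - s"] by (simp add: q_def)
    \<comment> \<open>Weakening \<open>t + 1\<close> to \<open>t\<close> puts both terms on one
      scale.\<close>
    moreover have "g\<^sup>2 / S * real (t + 1) powr (s - 1) \<le> l * real t powr (s - 1)"
      using g2[OF g] l s t by (intro mult_mono powr_mono2') auto
    ultimately have q: "q \<le> l * w\<^sup>2 * u" by (simp add: mult.assoc)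
    have q0: "0 \<le> q" using S by (simp add: q_def)
    have "\<phi> + (q + 2 * sqrt (q / 2 * (q / 2 + \<phi>))) \<le> A * u"
      by (rule strong_step[OF K A_def l c _ \<phi>0 q0 w \<phi>' q]) (simp add: u_def)
    moreover have "h_strong D S s (t + 1) g \<phi> \<le> \<phi> + (q + 2 * sqrt (q / 2 * (q / 2 + \<phi>)))"
    proof -
      have "g\<^sup>2 / (2 * S * real (t + 1) powr (1 - s)) = q / 2" by (simp add: q_def)
      then have "h_strong D S s (t + 1) g \<phi> = \<phi> + min (g * D) (q + 2 * sqrt (q / 2 * (q / 2 + \<phi>)))"
        using t unfolding h_strong_def q_def[symmetric] by (simp only:) simp
      then show ?thesis by simp
    qed
    moreover have "A * u \<le> A * real (t + 1) powr e"
      unfolding u_def using e A l by (intro mult_left_mono powr_mono2) auto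
    ultimately show "h_strong D S s (t + 1) g \<phi> \<le> A * real (t + 1) powr e" by linarith
  qed (fact gap_le_h_strong_1 gap_le_h_strong_Suc)+
  then have "(1 / real T) * (\<Sum>t=1..T. f t (x T) - f t z) \<le> A * real T powr (e - 1)"
    using z T by (intro average_regret)
  also have "e - 1 = - (2 * (1 + b) - s) / 3" by (simp add: e_def field_simps)
  finally show ?thesis by (simp add: A_def c_def l_def)
qed

end

end

section \<open>Combination of the two regret bounds\<close>

theorem theorem5p1:
  fixes P X :: "(real ^ 'n) set"
    and N :: "real ^ 'n \<Rightarrow> real"
    and f :: "nat \<Rightarrow> real ^ 'n \<Rightarrow> real"
    and b s K L C D :: real
  assumes "polytope P"
    and "is_norm N"
    and "D = norm_diameter N P"
    and "0 \<le> b" "b < 1" "0 \<le> s" "s < 1" "1 \<le> K"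
    and "P \<subseteq> X" "interior X \<noteq> {}"
    and "\<And>t. 1 \<le> t \<Longrightarrow> convex_on X (f t)"
    and "\<And>t. 1 \<le> t \<Longrightarrow> f t differentiable_on X"
    and "\<And>t. 1 \<le> t \<Longrightarrow> lipschitz_wrt N X L (f t)"
    and "\<And>t. 1 \<le> t \<Longrightarrow> smooth_with_curvature X P (C * real t powr (- b)) (f t)"
  shows
    "(\<forall>T\<ge>1. \<forall>x \<Phi> xstar.
        lazy_ocg_run N X P f K C b (\<lambda>t. real t powr (- (1 - b) / 2)) (h_plain D) T x \<Phi> \<longrightarrow>
        is_arg_min (\<lambda>z. \<Sum>t=1..T. f t z) (\<lambda>z. z \<in> P) xstar \<longrightarrow>
        (1 / real T) * (\<Sum>t=1..T. f t (x T) - f t xstar)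
          \<le> (C * K / (2 * (1 - b)) + L * (K + 1) * D) * real T powr (- (1 - b) / 2))
     \<and>
     (\<forall>S>0. (\<forall>t\<ge>1. strongly_convex_wrt N X P (S * real t powr (- s)) (f t)) \<longrightarrow>
       (\<forall>T\<ge>1. \<forall>x \<Phi> xstar.
          lazy_ocg_run N X P f K C b (\<lambda>t. real t powr ((b + s - 2) / 3)) (h_strong D S s) T x \<Phi> \<longrightarrow>
          is_arg_min (\<lambda>z. \<Sum>t=1..T. f t z) (\<lambda>z. z \<in> P) xstar \<longrightarrow>
          (1 / real T) * (\<Sum>t=1..T. f t (x T) - f t xstar)
            \<le> 2 * ((K + 1) * (K + 2) * (L\<^sup>2 / S) + C * K / (2 * (1 - b)))
               * real T powr (- (2 * (1 + b) - s) / 3)))"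
proof -
  interpret lazy_ocg N P X f K L C b
    by unfold_locales (use assms in auto)
  have arg_min: "z \<in> P" if "is_arg_min h (\<lambda>z. z \<in> P) z" for h :: "real ^ 'n \<Rightarrow> real" and z
    using that by (simp add: is_arg_min_def)
  show ?thesis
    unfolding \<open>D = norm_diameter N P\<close>
  proof (intro conjI allI impI)
    fix T x \<Phi> xstar
    assume "1 \<le> T"
      "lazy_ocg_run N X P f K C b (\<lambda>t. real t powr (- (1 - b) / 2)) (h_plain (norm_diameter N P)) T x \<Phi>"
      "is_arg_min (\<lambda>z. \<Sum>t=1..T. f t z) (\<lambda>z. z \<in> P) xstar"
    then show "(1 / real T) * (\<Sum>t=1..T. f t (x T) - f t xstar)
        \<le> (C * K / (2 * (1 - b)) + L * (K + 1) * norm_diameter N P) * real T powr (- (1 - b) / 2)"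
      by (intro regret_plain arg_min)
  next
    fix S T x \<Phi> xstar
    assume S: "0 < S" "\<forall>t\<ge>1. strongly_convex_wrt N X P (S * real t powr (- s)) (f t)"
      and T: "1 \<le> T"
      and run: "lazy_ocg_run N X P f K C b (\<lambda>t. real t powr ((b + s - 2) / 3))
        (h_strong (norm_diameter N P) S s) T x \<Phi>"
      and "is_arg_min (\<lambda>z. \<Sum>t=1..T. f t z) (\<lambda>z. z \<in> P) xstar"
    then have z: "xstar \<in> P" by (intro arg_min)
    have strong: "\<And>t. 1 \<le> t \<Longrightarrow> strongly_convex_wrt N X P (S * real t powr (- s)) (f t)"
      using S(2) by simp
    show "(1 / real T) * (\<Sum>t=1..T. f t (x T) - f t xstar)
        \<le> 2 * ((K + 1) * (K + 2) * (L\<^sup>2 / S) + C * K / (2 * (1 - b)))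
           * real T powr (- (2 * (1 + b) - s) / 3)"
    \<comment> \<open>If the points agree, the regret is 0 and the right-hand side nonnegative;
      otherwise they are the two distinct points of \<open>P\<close> that force
      \<open>b \<le> s\<close>.\<close>
    proof (cases "x T = xstar")
      case True
      then show ?thesis using S(1) assms(5,8) C_nonneg[OF z] by simp
    next
      case False
      have "x T \<in> P" using assms(4-7) T by (intro run_in_P[OF run]) (auto intro!: powr_le_one)
      then have "b \<le> s" by (intro curvature_exponents[of S s "x T" xstar] S(1) assms(6,7) strong z False)
      then show ?thesis by (intro regret_strong[of S s T x \<Phi>] S(1) assms(6,7) strong run T z)
    qed
  qed
qed

end
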